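(* The index of groups is $[L_n:H_n]=12$ and the quotient $L_n/H_n=A_4.$
   Context: Let $\mathcal{T}$ be the rooted $3$-ary tree whose vertices are words over $X=\{0,1,2\}$, and $\mathcal{T}_n$ its truncation at level $n$. Via sections, $\mathrm{Aut}(\mathcal{T}_n)\cong(\mathrm{Aut}(\mathcal{T}_{n-1})^3)\rtimes S_3$, and an element is written $(\sigma_0,\sigma_1,\sigma_2)\pi$ with $\sigma_i\in\mathrm{Aut}(\mathcal{T}_{n-1})$ and $\pi\in S_3$. $\mathrm{Aut}(\mathcal{T}_{n-1})$ is embedded in $\mathrm{Aut}(\mathcal{T}_n)$ by $\sigma\mapsto(\sigma,\mathrm{id},\mathrm{id})$. Define recursively $x_1=(0,1,2)$, $y_1=(0,1)$, $z_1=\mathrm{id}$ in $S_3=\mathrm{Aut}(\mathcal{T}_1)$, and for $n\ge2$: $x_n=(\mathrm{id},\mathrm{id},x_{n-1})(0,1,2)$, $y_n=(\mathrm{id},y_{n-1},x_{n-1})(0,1)$, $z_n=(y_{n-1},y_{n-1},x_{n-1})$. Let $L_0$ be trivial, $L_n=\langle x_n,z_n,L_{n-1}\rangle$, and $H_n=\langle L_{n-1}\rangle^{L_n}$ the normal closure of $L_{n-1}$ in $L_n$, which equals $L_{n-1}\times L_{n-1}^{x_n}\times L_{n-1}^{x_n^2}$.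
   Formalization: The claim is stated for n ≥ 2: for n = 1 it fails, since L_1 = ⟨(0,1,2)⟩ is cyclic of order 3 and H_1 is trivial, so the index is 3, and for n = 0 the group H_0 is not defined. *)

theory Defs
  imports "HOL-Algebra.Algebra"
begin

definition tree_verts :: "nat \<Rightarrow> nat list set" where
  "tree_verts n = {w. set w \<subseteq> {0, 1, 2} \<and> length w \<le> n}"

definition tree_child :: "nat list \<Rightarrow> nat list \<Rightarrow> bool" where
  "tree_child v w \<longleftrightarrow> (\<exists>i. w = v @ [i])"

text \<open>As for \<^const>\<open>sym_group\<close>, an automorphism of the truncated tree is a function on all words
  that is the identity outside the vertex set.\<close>

definition Aut_tree :: "nat \<Rightarrow> (nat list \<Rightarrow> nat list) monoid" where
  "Aut_tree n =
     \<lparr>carrier = {f. f permutes tree_verts n \<and> f [] = [] \<and>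
        (\<forall>v \<in> tree_verts n. \<forall>w \<in> tree_verts n. tree_child v w \<longleftrightarrow> tree_child (f v) (f w))},
      monoid.mult = (\<circ>), one = id\<rparr>"

text \<open>The element \<open>(s0, s1, s2) p\<close> of \<open>Aut_tree n\<close>, for \<open>s0, s1, s2\<close> in \<open>Aut_tree (n - 1)\<close> and \<open>p\<close> a
  permutation of \<open>{0, 1, 2}\<close>. The \<open>s\<^sub>i\<close> are its sections: \<open>i u\<close> is sent to \<open>p(i) s\<^sub>i(u)\<close>.\<close>

definition wreath ::
  "nat \<Rightarrow> (nat list \<Rightarrow> nat list) \<Rightarrow> (nat list \<Rightarrow> nat list) \<Rightarrow> (nat list \<Rightarrow> nat list) \<Rightarrow>
   (nat \<Rightarrow> nat) \<Rightarrow> nat list \<Rightarrow> nat list" where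
  "wreath n s0 s1 s2 p w =
     (if w \<in> tree_verts n then (case w of [] \<Rightarrow> [] | i # u \<Rightarrow> p i # ([s0, s1, s2] ! i) u) else w)"

definition tree_embed :: "nat \<Rightarrow> (nat list \<Rightarrow> nat list) \<Rightarrow> nat list \<Rightarrow> nat list" where
  "tree_embed n s = wreath n s id id id"

text \<open>The recursions start from the identity of the trivial group \<open>Aut_tree 0\<close>. This yields the
  intended elements \<open>(0,1,2)\<close>, \<open>(0,1)\<close>, \<open>id\<close> at level 1, see \<open>tree_gens_1\<close> below.\<close>

primrec tree_x :: "nat \<Rightarrow> nat list \<Rightarrow> nat list" where
  "tree_x 0 = id"
| "tree_x (Suc n) = wreath (Suc n) id id (tree_x n) (cycle_of_list [0, 1, 2])"

primrec tree_y :: "nat \<Rightarrow> nat list \<Rightarrow> nat list" where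
  "tree_y 0 = id"
| "tree_y (Suc n) = wreath (Suc n) id (tree_y n) (tree_x n) (cycle_of_list [0, 1])"

primrec tree_z :: "nat \<Rightarrow> nat list \<Rightarrow> nat list" where
  "tree_z 0 = id"
| "tree_z (Suc n) = wreath (Suc n) (tree_y n) (tree_y n) (tree_x n) id"

primrec L_set :: "nat \<Rightarrow> (nat list \<Rightarrow> nat list) set" where
  "L_set 0 = {id}"
| "L_set (Suc n) = generate (Aut_tree (Suc n))
     ({tree_x (Suc n), tree_z (Suc n)} \<union> tree_embed (Suc n) ` L_set n)"

definition L_group :: "nat \<Rightarrow> (nat list \<Rightarrow> nat list) monoid" where
  "L_group n = Aut_tree n\<lparr>carrier := L_set n\<rparr>"

definition normal_closure :: "('a, 'b) monoid_scheme \<Rightarrow> 'a set \<Rightarrow> 'a set" where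
  "normal_closure G S = \<Inter>{N. N \<lhd> G \<and> S \<subseteq> N}"

text \<open>Meaningful for \<open>n \<ge> 1\<close> only.\<close>

definition H_set :: "nat \<Rightarrow> (nat list \<Rightarrow> nat list) set" where
  "H_set n = normal_closure (L_group n) (tree_embed n ` L_set (n - 1))"

lemma cycle_012: "cycle_of_list [0, 1, 2::nat] 0 = 1" "cycle_of_list [0, 1, 2::nat] 1 = 2"
    "cycle_of_list [0, 1, 2::nat] 2 = 0"
  by (simp_all add: transpose_def)

lemma tree_gens_1:
  "tree_x 1 = wreath 1 id id id (cycle_of_list [0, 1, 2])"
  "tree_y 1 = wreath 1 id id id (cycle_of_list [0, 1])"
  "tree_z 1 = id"
  by (auto simp: wreath_def fun_eq_iff nth_Cons tree_verts_def split: list.split nat.split)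

lemma Aut_tree_simps [simp]:
  "monoid.mult (Aut_tree n) = (\<circ>)" "one (Aut_tree n) = id"
  by (simp_all add: Aut_tree_def)

lemma Aut_tree_group: "group (Aut_tree n)"
proof (rule groupI)
  fix f assume f: "f \<in> carrier (Aut_tree n)"
  let ?g = "inv_into UNIV f"
  have p: "f permutes tree_verts n" and r: "f [] = []"
    and c: "\<And>v w. v \<in> tree_verts n \<Longrightarrow> w \<in> tree_verts n \<Longrightarrow>
              tree_child v w \<longleftrightarrow> tree_child (f v) (f w)"
    using f by (auto simp: Aut_tree_def)
  have pg: "?g permutes tree_verts n" by (rule permutes_inv[OF p])
  have "tree_child v w \<longleftrightarrow> tree_child (?g v) (?g w)"
    if "v \<in> tree_verts n" "w \<in> tree_verts n" for v w
    using c[of "?g v" "?g w"] that permutes_in_image[OF pg] permutes_inverses[OF p] by simp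
  moreover have "?g [] = []" using r p by (metis permutes_inverses(2))
  ultimately have "?g \<in> carrier (Aut_tree n)" using pg by (auto simp: Aut_tree_def)
  moreover have "?g \<circ> f = id" by (rule permutes_inv_o(2)[OF p])
  ultimately show "\<exists>g \<in> carrier (Aut_tree n). g \<otimes>\<^bsub>Aut_tree n\<^esub> f = \<one>\<^bsub>Aut_tree n\<^esub>" by auto
next
  fix f g assume fg: "f \<in> carrier (Aut_tree n)" "g \<in> carrier (Aut_tree n)"
  then have p: "f permutes tree_verts n" "g permutes tree_verts n" by (auto simp: Aut_tree_def)
  then have "f \<circ> g permutes tree_verts n" by (metis permutes_compose)
  moreover have "g v \<in> tree_verts n" if "v \<in> tree_verts n" for v
    using that permutes_in_image[OF p(2)] by simp
  ultimately show "f \<otimes>\<^bsub>Aut_tree n\<^esub> g \<in> carrier (Aut_tree n)"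
    using fg by (simp add: Aut_tree_def)
qed (auto simp: Aut_tree_def permutes_id comp_assoc)

lemma wreath_Cons:
  assumes "i \<in> {0, 1, 2}" "u \<in> tree_verts n"
  shows "wreath (Suc n) s0 s1 s2 p (i # u) = p i # ([s0, s1, s2] ! i) u"
  using assms by (auto simp: wreath_def tree_verts_def)

lemma finite_tree_verts: "finite (tree_verts n)"
  unfolding tree_verts_def by (rule finite_lists_length_le) simp

lemma wreath_in_Aut_tree:
  assumes s: "s0 \<in> carrier (Aut_tree n)" "s1 \<in> carrier (Aut_tree n)" "s2 \<in> carrier (Aut_tree n)"
    and p: "p permutes {0, 1, 2}"
  shows "wreath (Suc n) s0 s1 s2 p \<in> carrier (Aut_tree (Suc n))"
proof -
  let ?V = "tree_verts (Suc n)" and ?f = "wreath (Suc n) s0 s1 s2 p"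
  have si: "[s0, s1, s2] ! i \<in> carrier (Aut_tree n)" if "i \<in> {0, 1, 2}" for i
    using that s by auto
  have sp: "([s0, s1, s2] ! i) permutes tree_verts n" if "i \<in> {0, 1, 2}" for i
    using si[OF that] by (simp add: Aut_tree_def)
  have sin: "([s0, s1, s2] ! i) u \<in> tree_verts n" if "i \<in> {0, 1, 2}" "u \<in> tree_verts n" for i u
    using permutes_in_image[OF sp[OF that(1)]] that(2) by simp
  have pin: "p i \<in> {0, 1, 2}" if "i \<in> {0, 1, 2}" for i
    using that by (simp only: permutes_in_image[OF p])
  have VCons: "i # u \<in> ?V \<longleftrightarrow> i \<in> {0, 1, 2} \<and> u \<in> tree_verts n" for i u
    by (auto simp: tree_verts_def)
  have nil: "?f [] = []" by (simp add: wreath_def tree_verts_def)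
  have fV: "?f w \<in> ?V" if "w \<in> ?V" for w
  proof (cases w)
    case Nil
    then show ?thesis using nil that by simp
  next
    case (Cons i u)
    with that have "i \<in> {0, 1, 2}" "u \<in> tree_verts n" using VCons by auto
    then show ?thesis using Cons VCons pin sin wreath_Cons by simp
  qed
  have inj: "inj_on ?f ?V"
  proof (rule inj_onI)
    fix v w assume v: "v \<in> ?V" and w: "w \<in> ?V" and e: "?f v = ?f w"
    show "v = w"
    proof (cases v; cases w)
      fix i u j t assume vw: "v = i # u" "w = j # t"
      have m: "i \<in> {0, 1, 2}" "u \<in> tree_verts n" "j \<in> {0, 1, 2}" "t \<in> tree_verts n"
        using v w vw VCons by auto
      have "p i = p j" "([s0, s1, s2] ! i) u = ([s0, s1, s2] ! j) t"
        using e vw m wreath_Cons by auto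
      then show "v = w"
        using vw permutes_inj[OF p] permutes_inj[OF sp[OF m(1)]] by (auto dest: injD)
    qed (use v w e VCons nil wreath_Cons in auto)
  qed
  have "?f ` ?V = ?V"
    by (rule card_subset_eq[OF finite_tree_verts]) (use fV card_image[OF inj] in auto)
  then have "?f permutes ?V"
    using inj by (intro bij_imp_permutes) (auto simp: bij_betw_def wreath_def)
  moreover have "tree_child v w \<longleftrightarrow> tree_child (?f v) (?f w)" if v: "v \<in> ?V" and w: "w \<in> ?V" for v w
  proof (cases w)
    case Nil
    then show ?thesis using nil by (simp add: tree_child_def)
  next
    case w': (Cons j t)
    then have m: "j \<in> {0, 1, 2}" "t \<in> tree_verts n" using w VCons by auto
    have sj: "([s0, s1, s2] ! j) [] = []" "([s0, s1, s2] ! j) permutes tree_verts n"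
      using si[OF m(1)] by (auto simp: Aut_tree_def)
    show ?thesis
    proof (cases v)
      case Nil
      have "([s0, s1, s2] ! j) t = [] \<longleftrightarrow> t = []"
        using sj permutes_inj[OF sj(2)] by (metis injD)
      then show ?thesis using Nil nil w' wreath_Cons[OF m] by (simp add: tree_child_def)
    next
      case v': (Cons i u)
      then have m': "i \<in> {0, 1, 2}" "u \<in> tree_verts n" using v VCons by auto
      have ch: "tree_child (a # x) (b # y) \<longleftrightarrow> a = b \<and> tree_child x y" for a b x y
        by (auto simp: tree_child_def)
      have "p i = p j \<longleftrightarrow> i = j" using permutes_inj[OF p] by (auto dest: injD)
      moreover have "tree_child u t \<longleftrightarrow> tree_child (([s0, s1, s2] ! j) u) (([s0, s1, s2] ! j) t)"
        using si[OF m(1)] m(2) m'(2) by (auto simp: Aut_tree_def)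
      ultimately show ?thesis using v' w' ch wreath_Cons[OF m] wreath_Cons[OF m'] by auto
    qed
  qed
  ultimately show ?thesis using nil by (simp add: Aut_tree_def)
qed

lemma id_in_Aut_tree: "id \<in> carrier (Aut_tree n)"
  using group.is_monoid[OF Aut_tree_group, THEN monoid.one_closed] by simp

lemma tree_gens_in_Aut_tree:
  "tree_x n \<in> carrier (Aut_tree n)" "tree_y n \<in> carrier (Aut_tree n)"
  "tree_z n \<in> carrier (Aut_tree n)"
proof -
  have c: "cycle_of_list [0, 1, 2::nat] permutes {0, 1, 2}"
    using cycle_permutes[of "[0, 1, 2::nat]"] by simp
  have t: "cycle_of_list [0, 1::nat] permutes {0, 1, 2}"
    by (rule permutes_subset[OF cycle_permutes]) auto
  show x: "tree_x n \<in> carrier (Aut_tree n)" for n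
  proof (induction n)
    case (Suc n)
    show ?case unfolding tree_x.simps by (intro wreath_in_Aut_tree id_in_Aut_tree c Suc)
  qed (simp add: id_in_Aut_tree[unfolded id_def] id_def)
  show y: "tree_y n \<in> carrier (Aut_tree n)" for n
  proof (induction n)
    case (Suc n)
    show ?case unfolding tree_y.simps by (intro wreath_in_Aut_tree id_in_Aut_tree t x Suc)
  qed (simp add: id_in_Aut_tree[unfolded id_def] id_def)
  show "tree_z n \<in> carrier (Aut_tree n)"
  proof (cases n)
    case (Suc m)
    show ?thesis
      unfolding Suc tree_z.simps by (intro wreath_in_Aut_tree x y permutes_id)
  qed (simp add: id_in_Aut_tree[unfolded id_def] id_def)
qed

lemma tree_embed_in_Aut_tree:
  "s \<in> carrier (Aut_tree n) \<Longrightarrow> tree_embed (Suc n) s \<in> carrier (Aut_tree (Suc n))"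
  unfolding tree_embed_def by (intro wreath_in_Aut_tree id_in_Aut_tree permutes_id)

lemma L_set_subgroup: "subgroup (L_set n) (Aut_tree n)"
proof (induction n)
  case 0
  show ?case using group.triv_subgroup[OF Aut_tree_group[of 0]] by simp
next
  case (Suc n)
  have "tree_embed (Suc n) ` L_set n \<subseteq> carrier (Aut_tree (Suc n))"
    using subgroup.subset[OF Suc] tree_embed_in_Aut_tree by blast
  then show ?case
    using tree_gens_in_Aut_tree[of "Suc n"]
    by (simp del: tree_x.simps tree_z.simps add: group.generate_is_subgroup[OF Aut_tree_group])
qed

lemma L_group_group: "group (L_group n)"
  unfolding L_group_def by (rule subgroup.subgroup_is_group[OF L_set_subgroup Aut_tree_group])

lemma (in group) normal_closure_normal:
  assumes "S \<subseteq> carrier G"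
  shows "normal_closure G S \<lhd> G"
proof -
  have ne: "{N. N \<lhd> G \<and> S \<subseteq> N} \<noteq> {}"
    using assms normal_self by blast
  have "subgroup (normal_closure G S) G"
    unfolding normal_closure_def
    by (rule subgroups_Inter) (use ne normal_imp_subgroup in auto)
  then show ?thesis
    unfolding normal_inv_iff normal_closure_def by blast
qed

lemma H_set_normal: "n \<ge> 1 \<Longrightarrow> H_set n \<lhd> L_group n"
  unfolding H_set_def
proof (rule group.normal_closure_normal[OF L_group_group])
  assume "n \<ge> 1"
  then obtain m where n: "n = Suc m" by (cases n) auto
  show "tree_embed n ` L_set (n - 1) \<subseteq> carrier (L_group n)"
    by (auto simp: n L_group_def intro: generate.incl)
qed

end

theory Submission
  imports Defs
begin

text \<open>Attach to an automorphism the sign of the permutation it induces on the first level. Let \<open>N\<^sub>1 = S\<^sub>3\<close>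
  and let \<open>N\<^sub>n\<close> consist of the \<open>(s\<^sub>0, s\<^sub>1, s\<^sub>2) p\<close> with \<open>s\<^sub>i\<close> in \<open>N\<^bsub>n-1\<^esub>\<close> and with the sign of \<open>p\<close> equal to the
  product of the signs of the \<open>s\<^sub>i\<close>. This is a group in which \<open>y\<^sub>n\<close> is odd and \<open>x\<^sub>n\<close>, \<open>z\<^sub>n\<close> are even, and by
  induction \<open>L\<^sub>n\<close> is its even part. For \<open>n \<ge> 2\<close>, sending an element of \<open>L\<^sub>n\<close> to \<open>p\<close> together with the signs
  of its sections maps \<open>L\<^sub>n\<close> onto the group of sign vectors of length 3 with product 1, extended by the
  cyclic group of order 3. This group is \<open>A\<^sub>4\<close>, and the kernel is \<open>L\<^bsub>n-1\<^esub>\<^sup>3\<close>. Conjugating by \<open>x\<^sub>n\<close> moves the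
  first factor of the kernel to the other two, so the kernel is the normal closure \<open>H\<^sub>n\<close>.\<close>

section \<open>Sections and products of tree automorphisms\<close>

text \<open>The sections form a function of the index so that they can be reindexed by a permutation
  of the children. Only the values of \<open>s\<close> at 0, 1, 2 matter.\<close>

definition node :: "nat \<Rightarrow> (nat \<Rightarrow> nat list \<Rightarrow> nat list) \<Rightarrow> (nat \<Rightarrow> nat) \<Rightarrow> nat list \<Rightarrow> nat list" where
  "node m s p = wreath (Suc m) (s 0) (s 1) (s 2) p"

lemma lessThan_3: "{..<3} = {0, 1, 2 :: nat}"
  by auto

lemma all_less_3: "(\<forall>i<3. P i) \<longleftrightarrow> P 0 \<and> P 1 \<and> P (2 :: nat)"
  by (auto simp: less_Suc_eq numeral_3_eq_3 numeral_2_eq_2)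

lemma Cons_in_tree_verts:
  "i # u \<in> tree_verts (Suc m) \<longleftrightarrow> i < 3 \<and> u \<in> tree_verts m"
  by (auto simp: tree_verts_def)

lemma Nil_in_tree_verts: "[] \<in> tree_verts m"
  by (auto simp: tree_verts_def)

lemma node_Nil: "node m s p [] = []"
  by (simp add: node_def wreath_def)

lemma node_Cons:
  assumes "i < 3" "u \<in> tree_verts m"
  shows "node m s p (i # u) = p i # s i u"
  using assms by (auto simp: node_def wreath_Cons numeral_3_eq_3 less_Suc_eq numeral_2_eq_2)

lemma node_outside: "w \<notin> tree_verts (Suc m) \<Longrightarrow> node m s p w = w"
  by (simp add: node_def wreath_def)

lemma node_in_Aut_tree:
  assumes "\<And>i. i < 3 \<Longrightarrow> s i \<in> carrier (Aut_tree m)" "p permutes {..<3}"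
  shows "node m s p \<in> carrier (Aut_tree (Suc m))"
  unfolding node_def using assms by (intro wreath_in_Aut_tree) (simp_all flip: lessThan_3 One_nat_def)

lemma node_id: "(\<And>i. i < 3 \<Longrightarrow> s i = id) \<Longrightarrow> node m s id = id"
proof
  fix w assume s: "\<And>i. i < 3 \<Longrightarrow> s i = id"
  show "node m s id w = id w"
  proof (cases "w \<in> tree_verts (Suc m)")
    case True
    then show ?thesis
      using s by (cases w) (auto simp: node_Nil node_Cons Cons_in_tree_verts)
  qed (simp add: node_outside)
qed

lemma Aut_tree_closed:
  assumes "f \<in> carrier (Aut_tree m)" "u \<in> tree_verts m"
  shows "f u \<in> tree_verts m"
  using assms by (auto simp: Aut_tree_def permutes_in_image)

text \<open>The right factor acts first and carries the subtree at \<open>i\<close> to the one at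
  \<open>q i\<close>, so the left factor contributes its section at \<open>q i\<close>. The sections
  \<open>t i\<close> have to preserve \<open>tree_verts m\<close> for the left factor to act through
  its sections again.\<close>

lemma node_comp:
  assumes t: "\<And>i. i < 3 \<Longrightarrow> t i \<in> carrier (Aut_tree m)"
    and q: "q permutes {..<3}"
  shows "node m s p \<circ> node m t q = node m (\<lambda>i. s (q i) \<circ> t i) (p \<circ> q)"
proof
  fix w
  show "(node m s p \<circ> node m t q) w = node m (\<lambda>i. s (q i) \<circ> t i) (p \<circ> q) w"
  proof (cases "w \<in> tree_verts (Suc m)")
    case True
    show ?thesis
    proof (cases w)
      case (Cons i u)
      with True have iu: "i < 3" "u \<in> tree_verts m" by (simp_all add: Cons_in_tree_verts)
      moreover have "q i < 3" using permutes_in_image[OF q] iu by blast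
      moreover have "t i u \<in> tree_verts m" using Aut_tree_closed t iu by blast
      ultimately show ?thesis using Cons by (simp add: node_Cons)
    qed (simp add: node_Nil)
  qed (simp add: node_outside)
qed

section \<open>Action on the first level, its sign, and the signed group\<close>

definition root_perm :: "(nat list \<Rightarrow> nat list) \<Rightarrow> nat \<Rightarrow> nat" where
  "root_perm g i = (if i < 3 then hd (g [i]) else i)"

definition root_sign :: "(nat list \<Rightarrow> nat list) \<Rightarrow> int" where
  "root_sign g = sign (root_perm g)"

lemma root_perm_id: "root_perm id = id"
  by (simp add: root_perm_def fun_eq_iff)

lemma root_perm_node: "p permutes {..<3} \<Longrightarrow> root_perm (node m s p) = p"
  using permutes_not_in[of p "{..<3}"]
  by (auto simp: fun_eq_iff root_perm_def node_Cons Nil_in_tree_verts)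

text \<open>For \<open>m \<ge> 1\<close> this is the group generated by \<open>L_set m\<close> and \<open>tree_y m\<close>. At level 1 the sections are
  trivial, so the sign condition has to be dropped there in order to obtain all of \<open>S\<^sub>3\<close>.\<close>

primrec signed_group :: "nat \<Rightarrow> (nat list \<Rightarrow> nat list) set" where
  "signed_group 0 = {id}"
| "signed_group (Suc m) = {node m s p | s p.
     (\<forall>i<3. s i \<in> signed_group m) \<and> p permutes {..<3} \<and>
     (m = 0 \<or> sign p = (\<Prod>i<3. root_sign (s i)))}"

lemma node_in_signed_group:
  assumes "\<And>i. i < 3 \<Longrightarrow> s i \<in> signed_group m" "p permutes {..<3}"
    "m \<noteq> 0 \<Longrightarrow> sign p = (\<Prod>i<3. root_sign (s i))"
  shows "node m s p \<in> signed_group (Suc m)"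
  unfolding signed_group.simps
  by (rule CollectI, rule exI[of _ s], rule exI[of _ p]) (use assms in auto)

lemma signed_group_SucE:
  assumes "g \<in> signed_group (Suc m)"
  obtains s p where "g = node m s p" "\<And>i. i < 3 \<Longrightarrow> s i \<in> signed_group m"
    "p permutes {..<3}" "m \<noteq> 0 \<Longrightarrow> sign p = (\<Prod>i<3. root_sign (s i))"
  using assms unfolding signed_group.simps by auto

text \<open>From here on cycles stay opaque in simplification, with their values taken from
  \<open>cycle_012\<close>, and the index 1 does not turn into \<open>Suc 0\<close>.\<close>

declare signed_group.simps(2) [simp del] cycle_of_list.simps [simp del] One_nat_def [simp del]

lemma signed_group_subset: "signed_group m \<subseteq> carrier (Aut_tree m)"
proof (induction m)
  case (Suc m)
  show ?case
  proof
    fix g assume "g \<in> signed_group (Suc m)"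
    then show "g \<in> carrier (Aut_tree (Suc m))"
      by (rule signed_group_SucE) (use Suc node_in_Aut_tree in blast)
  qed
qed (simp add: id_in_Aut_tree)

lemma root_perm_permutes: "g \<in> signed_group m \<Longrightarrow> root_perm g permutes {..<3}"
proof (cases m)
  case (Suc k)
  assume "g \<in> signed_group m"
  then show ?thesis unfolding Suc by (rule signed_group_SucE) (simp add: root_perm_node)
qed (simp add: root_perm_id permutes_id)

lemma node_comp_signed_group:
  assumes "\<And>i. i < 3 \<Longrightarrow> t i \<in> signed_group m" "q permutes {..<3}"
  shows "node m s p \<circ> node m t q = node m (\<lambda>i. s (q i) \<circ> t i) (p \<circ> q)"
  using assms signed_group_subset by (intro node_comp) blast+

lemma root_perm_comp:
  assumes "g \<in> signed_group m" "h \<in> signed_group m"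
  shows "root_perm (g \<circ> h) = root_perm g \<circ> root_perm h"
proof (cases m)
  case 0
  then show ?thesis using assms by (simp add: root_perm_id)
next
  case (Suc k)
  obtain s p where g: "g = node k s p" "p permutes {..<3}"
    using signed_group_SucE[OF assms(1)[unfolded Suc]] by metis
  obtain t q where h: "h = node k t q" "\<And>i. i < 3 \<Longrightarrow> t i \<in> signed_group k"
    "q permutes {..<3}"
    using signed_group_SucE[OF assms(2)[unfolded Suc]] by metis
  show ?thesis
    using g h permutes_compose[OF h(3) g(2)]
    by (simp add: node_comp_signed_group root_perm_node)
qed

lemma root_sign_id: "root_sign id = 1"
  by (simp add: root_sign_def root_perm_id)

lemma root_sign_node: "p permutes {..<3} \<Longrightarrow> root_sign (node m s p) = sign p"
  by (simp add: root_sign_def root_perm_node)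

lemma root_sign_cases: "root_sign g = 1 \<or> root_sign g = - 1"
  by (simp add: root_sign_def sign_def)

lemma permutation_permutes_3: "p permutes {..<3 :: nat} \<Longrightarrow> permutation p"
  by (rule permutes_imp_permutation[OF finite_lessThan])

lemma root_sign_comp:
  assumes "g \<in> signed_group m" "h \<in> signed_group m"
  shows "root_sign (g \<circ> h) = root_sign g * root_sign h"
  unfolding root_sign_def root_perm_comp[OF assms]
  by (rule sign_compose[OF assms[THEN root_perm_permutes, THEN permutation_permutes_3]])

text \<open>The sign condition survives because \<open>root_sign\<close> is multiplicative and the
  product over the three sections does not change when \<open>q\<close> reindexes them.\<close>

lemma signed_group_comp:
  "g \<in> signed_group m \<Longrightarrow> h \<in> signed_group m \<Longrightarrow> g \<circ> h \<in> signed_group m"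
proof (induction m arbitrary: g h)
  case (Suc m)
  obtain s p where g: "g = node m s p" "\<And>i. i < 3 \<Longrightarrow> s i \<in> signed_group m"
    "p permutes {..<3}" "m \<noteq> 0 \<Longrightarrow> sign p = (\<Prod>i<3. root_sign (s i))"
    using signed_group_SucE[OF Suc.prems(1)] by metis
  obtain t q where h: "h = node m t q" "\<And>i. i < 3 \<Longrightarrow> t i \<in> signed_group m"
    "q permutes {..<3}" "m \<noteq> 0 \<Longrightarrow> sign q = (\<Prod>i<3. root_sign (t i))"
    using signed_group_SucE[OF Suc.prems(2)] by metis
  have q: "q i < 3" if "i < 3" for i
    using permutes_in_image[OF h(3)] that by blast
  have "node m (\<lambda>i. s (q i) \<circ> t i) (p \<circ> q) \<in> signed_group (Suc m)"
  proof (rule node_in_signed_group)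
    show "s (q i) \<circ> t i \<in> signed_group m" if "i < 3" for i
      using Suc.IH g(2) h(2) q that by blast
    show "p \<circ> q permutes {..<3}" using permutes_compose g h by blast
    assume "m \<noteq> 0"
    have "(\<Prod>i<3. root_sign (s (q i) \<circ> t i))
        = (\<Prod>i<3. root_sign (s (q i)) * root_sign (t i))"
      using root_sign_comp g(2) h(2) q by (intro prod.cong refl) (metis lessThan_iff)
    also have "\<dots> = (\<Prod>i<3. root_sign (s (q i))) * (\<Prod>i<3. root_sign (t i))"
      by (rule prod.distrib)
    also have "(\<Prod>i<3. root_sign (s (q i))) = (\<Prod>i<3. root_sign (s i))"
      using prod.permute[OF h(3), of "\<lambda>i. root_sign (s i)"] by (simp add: comp_def)
    also have "\<dots> * (\<Prod>i<3. root_sign (t i)) = sign (p \<circ> q)"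
      using g h \<open>m \<noteq> 0\<close> by (simp add: sign_compose permutation_permutes_3)
    finally show "sign (p \<circ> q) = (\<Prod>i<3. root_sign (s (q i) \<circ> t i))" by (rule sym)
  qed
  then show ?case using g h by (simp add: node_comp_signed_group)
qed simp

lemma id_in_signed_group: "id \<in> signed_group m"
proof (induction m)
  case 0
  show ?case unfolding signed_group.simps by (rule singletonI)
next
  case (Suc m)
  have "node m (\<lambda>i. id) id \<in> signed_group (Suc m)"
    by (intro node_in_signed_group Suc permutes_id) (simp add: root_sign_id)
  moreover have "node m (\<lambda>i. id) id = id" by (rule node_id) (rule refl)
  ultimately show ?case by metis
qed

text \<open>The inverse is built from \<open>inv_into UNIV p\<close> at the root and the inverses
  \<open>t i\<close> of the sections, reindexed by the inverse permutation. A left inverse suffices,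
  since everything lies in the group \<open>Aut_tree m\<close>.\<close>

lemma signed_group_left_inverse:
  "g \<in> signed_group m \<Longrightarrow> \<exists>h \<in> signed_group m. h \<circ> g = id"
proof (induction m arbitrary: g)
  case (Suc m)
  obtain s p where g: "g = node m s p" "\<And>i. i < 3 \<Longrightarrow> s i \<in> signed_group m"
    "p permutes {..<3}" "m \<noteq> 0 \<Longrightarrow> sign p = (\<Prod>i<3. root_sign (s i))"
    using signed_group_SucE[OF Suc.prems] by metis
  have "\<forall>i \<in> {..<3}. \<exists>h. h \<in> signed_group m \<and> h \<circ> s i = id"
  proof
    fix i :: nat assume "i \<in> {..<3}"
    then have "s i \<in> signed_group m" using g(2) by simp
    from Suc.IH[OF this] show "\<exists>h. h \<in> signed_group m \<and> h \<circ> s i = id" unfolding Bex_def .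
  qed
  from bchoice[OF this] obtain t where t: "\<And>i. i < 3 \<Longrightarrow> t i \<in> signed_group m"
      "\<And>i. i < 3 \<Longrightarrow> t i \<circ> s i = id"
    by auto
  \<comment> \<open>The signs of \<open>t i\<close> and \<open>s i\<close> multiply to 1 and are 1
    or -1, so they agree.\<close>
  have sgn: "root_sign (t i) = root_sign (s i)" if "i < 3" for i
    using root_sign_comp[OF t(1)[OF that] g(2)[OF that]] t(2)[OF that]
      root_sign_cases[of "t i"] root_sign_cases[of "s i"] by (auto simp: root_sign_id)
  let ?q = "inv_into UNIV p"
  have q: "?q permutes {..<3}" by (rule permutes_inv[OF g(3)])
  have qi: "?q i < 3" if "i < 3" for i
    using permutes_in_image[OF q] that by blast
  have "node m (\<lambda>i. t (?q i)) ?q \<in> signed_group (Suc m)"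
  proof (rule node_in_signed_group[OF _ q])
    show "t (?q i) \<in> signed_group m" if "i < 3" for i
      using t(1) qi that by blast
    assume "m \<noteq> 0"
    have "(\<Prod>i<3. root_sign (t (?q i))) = (\<Prod>i<3. root_sign (t i))"
      using prod.permute[OF q, of "\<lambda>i. root_sign (t i)"] by (simp add: comp_def)
    also have "\<dots> = (\<Prod>i<3. root_sign (s i))"
      using sgn by (intro prod.cong refl) simp
    finally show "sign ?q = (\<Prod>i<3. root_sign (t (?q i)))"
      using g(4) \<open>m \<noteq> 0\<close> sign_inverse[OF permutation_permutes_3[OF g(3)]] by simp
  qed
  moreover have "node m (\<lambda>i. t (?q i)) ?q \<circ> g = id"
  proof -
    have "node m (\<lambda>i. t (?q i)) ?q \<circ> g = node m (\<lambda>i. t (?q (p i)) \<circ> s i) (?q \<circ> p)"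
      unfolding g(1) by (rule node_comp_signed_group[OF g(2,3)])
    then show ?thesis
      using t(2) by (simp add: permutes_inverses(2)[OF g(3)] permutes_inv_o(2)[OF g(3)] node_id)
  qed
  ultimately show ?case by blast
next
  case 0
  then show ?case by (intro bexI[of _ id]) auto
qed

section \<open>The even subgroup, and permutations of three points\<close>

definition even_group :: "nat \<Rightarrow> (nat list \<Rightarrow> nat list) set" where
  "even_group m = {g \<in> signed_group m. root_sign g = 1}"

lemma even_group_subgroup: "subgroup (even_group m) (Aut_tree m)"
proof (rule group.subgroupI[OF Aut_tree_group])
  show "even_group m \<subseteq> carrier (Aut_tree m)"
    using signed_group_subset by (auto simp: even_group_def)
  show "even_group m \<noteq> {}"
    using id_in_signed_group root_sign_id by (auto simp: even_group_def)
  show "g \<otimes>\<^bsub>Aut_tree m\<^esub> h \<in> even_group m" if "g \<in> even_group m" "h \<in> even_group m" for g h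
    using that by (simp add: even_group_def signed_group_comp root_sign_comp[of g m h])
  fix g assume "g \<in> even_group m"
  then have g: "g \<in> signed_group m" "root_sign g = 1" by (auto simp: even_group_def)
  obtain h where h: "h \<in> signed_group m" "h \<circ> g = id"
    using signed_group_left_inverse[OF g(1)] by blast
  have "inv\<^bsub>Aut_tree m\<^esub> g = h"
    using group.inv_equality[OF Aut_tree_group] h g signed_group_subset[of m] by auto
  then show "inv\<^bsub>Aut_tree m\<^esub> g \<in> even_group m"
    using h g root_sign_comp[OF h(1) g(1)] by (simp add: even_group_def root_sign_id)
qed

lemma cycle_permutes_sign:
  "cycle_of_list [0, 1, 2::nat] permutes {..<3}" "sign (cycle_of_list [0, 1, 2::nat]) = 1"
  "cycle_of_list [0, 1::nat] permutes {..<3}" "sign (cycle_of_list [0, 1::nat]) = - 1"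
proof -
  show "cycle_of_list [0, 1, 2::nat] permutes {..<3}"
    using cycle_permutes[of "[0, 1, 2::nat]"] by (simp add: lessThan_3)
  show "cycle_of_list [0, 1::nat] permutes {..<3}"
    by (rule permutes_subset[OF cycle_permutes]) auto
qed (simp_all add: cycle_of_list.simps sign_compose permutation_swap_id sign_swap_id)

lemma permutes_3_cases:
  assumes "p permutes {..<3 :: nat}"
  shows "(p 0, p 1, p 2) \<in> {(0, 1, 2), (0, 2, 1), (1, 0, 2), (1, 2, 0), (2, 0, 1), (2, 1, 0)}"
proof -
  have "p i < 3" if "i < 3" for i
    using permutes_in_image[OF assms, of i] that by simp
  from this[of 0] this[of 1] this[of 2]
  have "p 0 = 0 \<or> p 0 = 1 \<or> p 0 = 2" "p 1 = 0 \<or> p 1 = 1 \<or> p 1 = 2"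
    "p 2 = 0 \<or> p 2 = 1 \<or> p 2 = 2" by simp_all arith+
  moreover have "p 0 \<noteq> p 1" "p 0 \<noteq> p 2" "p 1 \<noteq> p 2"
    by (simp_all add: inj_eq[OF permutes_inj[OF assms]])
  ultimately show ?thesis by (elim disjE; simp)
qed

lemma permutes_3_eqI:
  assumes "p permutes {..<3 :: nat}" "q permutes {..<3}" "p 0 = q 0" "p 1 = q 1" "p 2 = q 2"
  shows "p = q"
proof
  fix i
  have "\<forall>i<3. p i = q i" using assms(3-5) by (simp add: all_less_3)
  then show "p i = q i"
    using permutes_not_in[OF assms(1), of i] permutes_not_in[OF assms(2), of i] by fastforce
qed

text \<open>The remaining three permutations of three points are transpositions, hence odd.\<close>

lemma even_permutes_3_cases:
  assumes p: "p permutes {..<3::nat}" "sign p = 1"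
  shows "p \<in> {id, cycle_of_list [0, 1, 2], cycle_of_list [0, 1, 2] \<circ> cycle_of_list [0, 1, 2]}"
proof -
  let ?c = "cycle_of_list [0, 1, 2::nat]"
  have tr: "transpose a b permutes {..<3}" "p \<noteq> transpose a b"
    if "a < 3" "b < 3" "a \<noteq> b" for a b :: nat
    using that p(2) by (auto intro!: permutes_swap_id simp: sign_swap_id)
  have c2: "?c \<circ> ?c permutes {..<3}"
    by (intro permutes_compose cycle_permutes_sign)
  consider "p 0 = 0" "p 1 = 1" "p 2 = 2" | "p 0 = 0" "p 1 = 2" "p 2 = 1"
    | "p 0 = 1" "p 1 = 0" "p 2 = 2" | "p 0 = 1" "p 1 = 2" "p 2 = 0"
    | "p 0 = 2" "p 1 = 0" "p 2 = 1" | "p 0 = 2" "p 1 = 1" "p 2 = 0"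
    using permutes_3_cases[OF p(1)] by auto
  then show ?thesis
  proof cases
    case 1
    then have "p = id" by (intro permutes_3_eqI[OF p(1) permutes_id]) auto
    then show ?thesis by simp
  next
    case 2
    then have "p = transpose 1 2"
      by (intro permutes_3_eqI[OF p(1) tr(1)]) (auto simp: transpose_def)
    then show ?thesis using tr(2)[of 1 2] by simp
  next
    case 3
    then have "p = transpose 0 1"
      by (intro permutes_3_eqI[OF p(1) tr(1)]) (auto simp: transpose_def)
    then show ?thesis using tr(2)[of 0 1] by simp
  next
    case 4
    then have "p = ?c" by (intro permutes_3_eqI[OF p(1) cycle_permutes_sign(1)]) (simp_all add: cycle_012)
    then show ?thesis by simp
  next
    case 5
    then have "p = ?c \<circ> ?c" by (intro permutes_3_eqI[OF p(1) c2]) (simp_all add: cycle_012)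
    then show ?thesis by simp
  next
    case 6
    then have "p = transpose 0 2"
      by (intro permutes_3_eqI[OF p(1) tr(1)]) (auto simp: transpose_def)
    then show ?thesis using tr(2)[of 0 2] by simp
  qed
qed

lemma wreath_eq_node: "wreath (Suc m) a b c p = node m ((!) [a, b, c]) p"
  by (simp add: node_def)

text \<open>With three explicit sections, a product of concrete elements can be evaluated by
  simplification alone.\<close>

lemma wreath_comp:
  assumes "a' \<in> carrier (Aut_tree m)" "b' \<in> carrier (Aut_tree m)" "c' \<in> carrier (Aut_tree m)"
    and "q permutes {..<3}"
  shows "wreath (Suc m) a b c p \<circ> wreath (Suc m) a' b' c' q =
    wreath (Suc m) ([a, b, c] ! q 0 \<circ> a') ([a, b, c] ! q 1 \<circ> b') ([a, b, c] ! q 2 \<circ> c') (p \<circ> q)"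
proof -
  have *: "[a', b', c'] ! i \<in> carrier (Aut_tree m)" if "i < 3" for i
    using that assms all_less_3[of "\<lambda>i. [a', b', c'] ! i \<in> carrier (Aut_tree m)"] by simp
  from node_comp[where t = "(!) [a', b', c']" and s = "(!) [a, b, c]" and p = p, OF * assms(4)]
  show ?thesis by (simp add: node_def)
qed

lemma wreath_in_signed_group:
  assumes "a \<in> signed_group m" "b \<in> signed_group m" "c \<in> signed_group m" "p permutes {..<3}"
    "m \<noteq> 0 \<Longrightarrow> sign p = root_sign a * root_sign b * root_sign c"
  shows "wreath (Suc m) a b c p \<in> signed_group (Suc m)"
  unfolding wreath_eq_node
proof (rule node_in_signed_group[OF _ assms(4)])
  show "[a, b, c] ! i \<in> signed_group m" if "i < 3" for i
    using that assms all_less_3[of "\<lambda>i. [a, b, c] ! i \<in> signed_group m"] by simp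
qed (use assms(5) in \<open>simp add: lessThan_3\<close>)

lemma root_sign_wreath: "p permutes {..<3} \<Longrightarrow> root_sign (wreath (Suc m) a b c p) = sign p"
  by (simp add: wreath_eq_node root_sign_node)

lemma id_in_even_group: "id \<in> even_group m"
  unfolding even_group_def using id_in_signed_group root_sign_id by blast

section \<open>Parity of the generators, and \<open>L_set\<close> as the even group\<close>

lemma tree_gens_0: "tree_x 0 = id" "tree_y 0 = id" "tree_z 0 = id"
  by (auto simp: fun_eq_iff)

lemma tree_x_even: "tree_x m \<in> even_group m"
proof (induction m)
  case 0
  show ?case unfolding tree_gens_0 by (rule id_in_even_group)
next
  case (Suc m)
  then show ?case
    using cycle_permutes_sign id_in_signed_group[of m]
    by (simp add: even_group_def wreath_in_signed_group root_sign_wreath root_sign_id)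
qed

text \<open>At level \<open>Suc m\<close> with \<open>m\<close> nonzero, the transposition is odd
  and exactly one section, \<open>tree_y m\<close>, is odd. Level 0 is excepted because
  \<open>tree_y 0\<close> is the identity.\<close>

lemma tree_y_signed: "tree_y m \<in> signed_group m \<and> (m \<noteq> 0 \<longrightarrow> root_sign (tree_y m) = - 1)"
proof (induction m)
  case 0
  show ?case unfolding tree_gens_0 using id_in_signed_group by blast
next
  case (Suc m)
  then show ?case
    using cycle_permutes_sign id_in_signed_group[of m] tree_x_even[of m]
    by (simp add: even_group_def wreath_in_signed_group root_sign_wreath root_sign_id)
qed

text \<open>The signs of the two sections \<open>tree_y k\<close> cancel, matching the trivial root
  permutation.\<close>

lemma tree_z_even: "tree_z m \<in> even_group m"
proof (cases m)
  case 0
  then show ?thesis using tree_gens_0(3) id_in_even_group by metis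
next
  case (Suc k)
  show ?thesis
    using tree_y_signed[of k] tree_x_even[of k] unfolding Suc
    by (auto simp add: even_group_def wreath_in_signed_group root_sign_wreath root_sign_id)
qed

text \<open>The odd element \<open>tree_y m\<close> represents the nontrivial coset of the even
  part, so splitting it off flips the parity.\<close>

lemma tree_y_factor:
  assumes "m \<noteq> 0" "g \<in> signed_group m"
  shows "\<exists>h \<in> signed_group m. g = tree_y m \<circ> h \<and> root_sign h = - root_sign g"
proof -
  have y: "tree_y m \<in> signed_group m" "root_sign (tree_y m) = - 1"
    using tree_y_signed assms(1) by auto
  obtain z where z: "z \<in> signed_group m" "z \<circ> tree_y m = id"
    using signed_group_left_inverse[OF y(1)] by blast
  have "tree_y m \<circ> z = id"
    using group.inv_comm[OF Aut_tree_group[of m], of z "tree_y m"] z y(1) signed_group_subset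
    by auto
  then have eq: "g = tree_y m \<circ> (z \<circ> g)"
    by (simp add: o_assoc)
  have zg: "z \<circ> g \<in> signed_group m"
    using z assms(2) signed_group_comp by blast
  have "root_sign g = - root_sign (z \<circ> g)"
    using root_sign_comp[OF y(1) zg] y(2) unfolding eq[symmetric] by simp
  then have "root_sign (z \<circ> g) = - root_sign g" by simp
  with zg eq show ?thesis by blast
qed

text \<open>In the induction step, three kinds of elements are found in
  \<open>L_set (Suc m)\<close>: all triples of even sections (\<open>base\<close>), pairs of
  sections \<open>tree_y m\<close> (\<open>yy\<close>, \<open>yy'\<close>), and the even root
  permutations with trivial sections (\<open>rigid\<close>). Every even element is a product of
  these.\<close>

lemma L_set_eq_even_group: "L_set m = even_group m"
proof (induction m)
  case 0
  show ?case by (auto simp: even_group_def root_sign_id)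
next
  case (Suc m)
  let ?G = "Aut_tree (Suc m)" and ?K = "L_set (Suc m)" and ?w = "wreath (Suc m)"
  let ?c = "cycle_of_list [0, 1, 2::nat]"
  interpret G: group ?G by (rule Aut_tree_group)
  have even: "\<And>g. g \<in> even_group m \<Longrightarrow> g \<in> carrier (Aut_tree m)"
    using subgroup.subset[OF even_group_subgroup] by blast
  have id_even: "id \<in> even_group m" by (rule id_in_even_group)
  have x_even: "tree_x m \<in> even_group m" by (rule tree_x_even)
  have y: "tree_y m \<in> carrier (Aut_tree m)" and x: "tree_x m \<in> carrier (Aut_tree m)"
    by (rule tree_gens_in_Aut_tree)+
  have K: "subgroup ?K ?G" by (rule L_set_subgroup)
  have wK: "?w a b c p \<in> carrier ?G"
    if "a \<in> carrier (Aut_tree m)" "b \<in> carrier (Aut_tree m)" "c \<in> carrier (Aut_tree m)"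
      "p permutes {..<3}" for a b c p
    using wreath_in_Aut_tree[OF that(1-3)] that(4) by (simp add: lessThan_3)
  have K_comp: "g \<circ> h \<in> ?K" if "g \<in> ?K" "h \<in> ?K" for g h
    using subgroup.m_closed[OF K that] by simp
  \<comment> \<open>Membership is obtained below by cancelling a known factor, which avoids
    computing inverses in coordinates.\<close>
  have K_cancel_right: "g \<in> ?K" if "g \<circ> h \<in> ?K" "h \<in> ?K" "g \<in> carrier ?G" for g h
  proof -
    have "g = (g \<otimes>\<^bsub>?G\<^esub> h) \<otimes>\<^bsub>?G\<^esub> inv\<^bsub>?G\<^esub> h"
      using that subgroup.mem_carrier[OF K] by (simp add: G.m_assoc G.r_inv del: Aut_tree_simps)
    then show ?thesis
      using that subgroup.m_closed[OF K] subgroup.m_inv_closed[OF K] by simp metis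
  qed
  have K_cancel_left: "g \<in> ?K" if "h \<circ> g \<in> ?K" "h \<in> ?K" "g \<in> carrier ?G" for g h
  proof -
    have "g = inv\<^bsub>?G\<^esub> h \<otimes>\<^bsub>?G\<^esub> (h \<otimes>\<^bsub>?G\<^esub> g)"
      using that subgroup.mem_carrier[OF K] by (simp add: G.m_assoc[symmetric] del: Aut_tree_simps)
    then show ?thesis
      using that subgroup.m_closed[OF K] subgroup.m_inv_closed[OF K] by simp metis
  qed
  have gens: "tree_x (Suc m) \<in> ?K" "tree_z (Suc m) \<in> ?K"
    "\<And>l. l \<in> even_group m \<Longrightarrow> ?w l id id id \<in> ?K"
    by (auto intro!: generate.incl simp: Suc tree_embed_def
        simp del: tree_x.simps tree_z.simps)
  note comp_simps = wreath_comp id_in_Aut_tree cycle_permutes_sign cycle_012 even x y permutes_id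
  \<comment> \<open>Conjugation by \<open>tree_x (Suc m)\<close> carries the first section to the
    second, and in \<open>base2\<close> the second to the third. The only nontrivial section of
    \<open>tree_x (Suc m)\<close> is the third, so \<open>l\<close> is moved unchanged.\<close>
  have base1: "?w id l id id \<in> ?K" if l: "l \<in> even_group m" for l
  proof (rule K_cancel_right[OF _ gens(1) wK])
    have "?w id l id id \<circ> tree_x (Suc m) = tree_x (Suc m) \<circ> ?w l id id id"
      using l unfolding tree_x.simps by (simp add: comp_simps )
    then show "?w id l id id \<circ> tree_x (Suc m) \<in> ?K"
      using K_comp gens l by metis
  qed (simp_all add: comp_simps l)
  have base2: "?w id id l id \<in> ?K" if l: "l \<in> even_group m" for l
  proof (rule K_cancel_right[OF _ gens(1) wK])
    have "?w id id l id \<circ> tree_x (Suc m) = tree_x (Suc m) \<circ> ?w id l id id"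
      using l unfolding tree_x.simps by (simp add: comp_simps )
    then show "?w id id l id \<circ> tree_x (Suc m) \<in> ?K"
      using K_comp gens base1 l by metis
  qed (simp_all add: comp_simps l)
  have base: "?w a b c id \<in> ?K"
    if l: "a \<in> even_group m" "b \<in> even_group m" "c \<in> even_group m" for a b c
  proof -
    have "?w a b c id = ?w a id id id \<circ> (?w id b id id \<circ> ?w id id c id)"
      using l by (simp add: comp_simps)
    then show ?thesis using K_comp gens base1 base2 l by metis
  qed
  \<comment> \<open>This is \<open>tree_z (Suc m)\<close> with its third section, which is even,
    cancelled.\<close>
  have yy: "?w (tree_y m) (tree_y m) id id \<in> ?K"
  proof (rule K_cancel_right[OF _ base2[OF x_even] wK])
    have "?w (tree_y m) (tree_y m) id id \<circ> ?w id id (tree_x m) id = tree_z (Suc m)"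
      by (simp add: comp_simps)
    then show "?w (tree_y m) (tree_y m) id id \<circ> ?w id id (tree_x m) id \<in> ?K"
      using gens by metis
  qed (simp_all add: comp_simps)
  have yy': "?w id (tree_y m) (tree_y m) id \<in> ?K"
  proof (rule K_cancel_right[OF _ gens(1) wK])
    have "?w id (tree_y m) (tree_y m) id \<circ> tree_x (Suc m)
        = tree_x (Suc m) \<circ> ?w (tree_y m) (tree_y m) id id"
      unfolding tree_x.simps by (simp add: comp_simps )
    then show "?w id (tree_y m) (tree_y m) id \<circ> tree_x (Suc m) \<in> ?K"
      using K_comp gens yy by metis
  qed (simp_all add: comp_simps)
  \<comment> \<open>Since \<open>?c\<close> sends 2 to 0, the third section of
    \<open>tree_x (Suc m)\<close> can be pulled out to the left as a first section and
    cancelled.\<close>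
  have cyc: "?w id id id ?c \<in> ?K"
  proof (rule K_cancel_left[OF _ gens(3)[OF x_even] wK])
    have "?w (tree_x m) id id id \<circ> ?w id id id ?c = tree_x (Suc m)"
      by (simp add: comp_simps )
    then show "?w (tree_x m) id id id \<circ> ?w id id id ?c \<in> ?K"
      using gens by metis
  qed (simp_all add: comp_simps )
  have rigid: "?w id id id p \<in> ?K" if "p permutes {..<3}" "sign p = 1" for p
  proof -
    have "?w id id id (?c \<circ> ?c) = ?w id id id ?c \<circ> ?w id id id ?c"
      by (simp add: comp_simps )
    then show ?thesis
      using even_permutes_3_cases[OF that] cyc base[OF id_even id_even id_even] K_comp by auto
  qed
  have "even_group (Suc m) \<subseteq> ?K"
  proof
    fix g assume g: "g \<in> even_group (Suc m)"
    then have "g \<in> signed_group (Suc m)" by (simp add: even_group_def)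
    then obtain s p where sp: "g = node m s p" "\<And>i. i < 3 \<Longrightarrow> s i \<in> signed_group m"
      "p permutes {..<3}" "m \<noteq> 0 \<Longrightarrow> sign p = (\<Prod>i<3. root_sign (s i))"
      using signed_group_SucE by metis
    have s: "s 0 \<in> signed_group m" "s 1 \<in> signed_group m" "s 2 \<in> signed_group m"
      using sp(2) by auto
    have s': "s 0 \<in> carrier (Aut_tree m)" "s 1 \<in> carrier (Aut_tree m)" "s 2 \<in> carrier (Aut_tree m)"
      using s signed_group_subset by blast+
    have p: "sign p = 1" using g sp(1,3) by (simp add: even_group_def root_sign_node)
    have "?w (s 0) (s 1) (s 2) id \<in> ?K"
    proof (cases "root_sign (s 0) = 1 \<and> root_sign (s 1) = 1 \<and> root_sign (s 2) = 1")
      case True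
      then show ?thesis using base s by (simp add: even_group_def)
    next
      case False
      \<comment> \<open>At level 0 the only section is the identity, which is even, so an odd
        section forces \<open>m\<close> to be positive.\<close>
      have m: "m \<noteq> 0"
      proof
        assume "m = 0"
        then show False using False s by (simp add: root_sign_id)
      qed
      have prod: "root_sign (s 0) * root_sign (s 1) * root_sign (s 2) = 1"
        using sp(4)[OF m] p by (simp add: lessThan_3)
      obtain t where t: "\<And>i. i < 3 \<Longrightarrow> t i \<in> signed_group m"
        "\<And>i. i < 3 \<Longrightarrow> s i = tree_y m \<circ> t i" "\<And>i. i < 3 \<Longrightarrow> root_sign (t i) = - root_sign (s i)"
        using tree_y_factor[OF m sp(2)] by metis
      have te: "t i \<in> even_group m" if "i < 3" "root_sign (s i) = - 1" for i
        using that t by (simp add: even_group_def)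
      have se: "s i \<in> even_group m" if "i < 3" "root_sign (s i) = 1" for i
        using that sp(2) by (simp add: even_group_def)
      \<comment> \<open>The signs multiply to 1 and are not all 1, so exactly two sections are
        odd.\<close>
      consider "root_sign (s 0) = - 1" "root_sign (s 1) = - 1" "root_sign (s 2) = 1"
        | "root_sign (s 0) = 1" "root_sign (s 1) = - 1" "root_sign (s 2) = - 1"
        | "root_sign (s 0) = - 1" "root_sign (s 1) = 1" "root_sign (s 2) = - 1"
        using False prod root_sign_cases[of "s 0"] root_sign_cases[of "s 1"]
          root_sign_cases[of "s 2"] by fastforce
      then show ?thesis
      proof cases
        case 1
        have e: "t 0 \<in> even_group m" "t 1 \<in> even_group m" "s 2 \<in> even_group m"
          using 1 te se by simp_all
        have "?w (s 0) (s 1) (s 2) id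
            = ?w (tree_y m) (tree_y m) id id \<circ> ?w (t 0) (t 1) (s 2) id"
          using e t(2)[of 0] t(2)[of 1] by (simp add: comp_simps)
        then show ?thesis using K_comp yy base[OF e] by metis
      next
        case 2
        have e: "s 0 \<in> even_group m" "t 1 \<in> even_group m" "t 2 \<in> even_group m"
          using 2 te se by simp_all
        have "?w (s 0) (s 1) (s 2) id
            = ?w id (tree_y m) (tree_y m) id \<circ> ?w (s 0) (t 1) (t 2) id"
          using e t(2)[of 1] t(2)[of 2] by (simp add: comp_simps)
        then show ?thesis using K_comp yy' base[OF e] by metis
      next
        case 3
        \<comment> \<open>The pairs available are at positions 0, 1 and at 1, 2. Their product has
          \<open>tree_y m\<close> at both ends and its square in the middle, so
          \<open>tree_y m\<close> is split off twice from the even section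
          \<open>s 1\<close>.\<close>
        obtain r where r: "r \<in> signed_group m" "t 1 = tree_y m \<circ> r" "root_sign r = - root_sign (t 1)"
          using tree_y_factor[OF m t(1)[of 1]] by auto
        have e: "t 0 \<in> even_group m" "r \<in> even_group m" "t 2 \<in> even_group m"
          using 3 te r t(3)[of 1] by (simp_all add: even_group_def)
        have yr: "tree_y m \<circ> r \<in> carrier (Aut_tree m)" "tree_y m \<circ> t 2 \<in> carrier (Aut_tree m)"
          using r(2) t(1)[of 1] s'(3) t(2)[of 2] signed_group_subset[of m] by auto
        have "?w (s 0) (s 1) (s 2) id
            = ?w (tree_y m) (tree_y m) id id \<circ>
              (?w id (tree_y m) (tree_y m) id \<circ> ?w (t 0) r (t 2) id)"
          using e yr r(2) t(2)[of 0] t(2)[of 1] t(2)[of 2] by (simp add: comp_simps)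
        then show ?thesis using K_comp yy yy' base[OF e] by metis
      qed
    qed
    moreover have "g = ?w id id id p \<circ> ?w (s 0) (s 1) (s 2) id"
      using s' by (simp add: comp_simps sp(1) node_def)
    ultimately show "g \<in> ?K"
      using K_comp rigid[OF sp(3) p] by metis
  qed
  moreover have "?K \<subseteq> even_group (Suc m)"
  proof -
    have "tree_embed (Suc m) l \<in> even_group (Suc m)" if "l \<in> L_set m" for l
      using that unfolding Suc tree_embed_def
      by (simp add: even_group_def wreath_in_signed_group root_sign_wreath id_in_signed_group
          root_sign_id permutes_id)
    then show ?thesis
      unfolding L_set.simps using tree_x_even[of "Suc m"] tree_z_even[of "Suc m"]
      by (intro G.generate_subgroup_incl even_group_subgroup) blast
  qed
  ultimately show ?case by blast
qed

section \<open>Section signs and the Klein four-group\<close>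

definition subtree :: "(nat list \<Rightarrow> nat list) \<Rightarrow> nat \<Rightarrow> nat list \<Rightarrow> nat list" where
  "subtree g i u = tl (g (i # u))"

definition section_sign :: "(nat list \<Rightarrow> nat list) \<Rightarrow> nat \<Rightarrow> int" where
  "section_sign g i = root_sign (subtree g i)"

text \<open>The sign only depends on the images of one-letter words, and these are vertices of the
  subtree because \<open>m\<close> is not 0.\<close>

lemma section_sign_node:
  assumes "m \<noteq> 0" "i < 3"
  shows "section_sign (node m s p) i = root_sign (s i)"
proof -
  have "root_perm (subtree (node m s p) i) = root_perm (s i)"
  proof
    fix j
    have "[j] \<in> tree_verts m" if "j < 3"
      using that assms(1) by (auto simp: tree_verts_def)
    then show "root_perm (subtree (node m s p) i) j = root_perm (s i) j"
      using assms(2) by (simp add: root_perm_def subtree_def node_Cons)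
  qed
  then show ?thesis by (simp add: section_sign_def root_sign_def)
qed

text \<open>These are the sign vectors with product 1, listed so that proofs can split into four
  cases. Values beyond index 2 are unconstrained.\<close>

definition even_signs :: "(nat \<Rightarrow> int) \<Rightarrow> bool" where
  "even_signs e \<longleftrightarrow> (e 0, e 1, e 2) \<in> {(1, 1, 1), (1, -1, -1), (-1, 1, -1), (-1, -1, 1)}"

text \<open>The Klein four-group as the translations of the quotient of \<open>{1,-1}^3\<close> by \<open>{1,-1}\<close>: the point 3
  is the class of the trivial sign vector and \<open>i < 3\<close> that of the vector with a single -1 at \<open>i\<close>.
  Permutations of the coordinates then act on the points by the same permutation, fixing 3.\<close>

definition klein :: "(nat \<Rightarrow> int) \<Rightarrow> nat \<Rightarrow> nat" where
  "klein e =
     (if e 0 = 1 \<and> e 1 = 1 then id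
      else if e 2 = 1 then transpose 2 3 \<circ> transpose 0 1
      else if e 1 = 1 then transpose 1 3 \<circ> transpose 0 2
      else transpose 0 3 \<circ> transpose 1 2)"

text \<open>Composing two translations multiplies their sign vectors; the identity is checked point
  by point.\<close>

lemma klein_comp:
  assumes "even_signs e" "even_signs f"
  shows "klein e \<circ> klein f = klein (\<lambda>i. e i * f i)"
proof
  fix j :: nat
  consider "j = 0" | "j = 1" | "j = 2" | "j = 3" | "3 < j" by linarith
  then show "(klein e \<circ> klein f) j = klein (\<lambda>i. e i * f i) j"
    using assms unfolding even_signs_def insert_iff empty_iff prod.inject
    by cases (elim disjE conjE; simp add: klein_def transpose_def)+
qed

text \<open>This is the commutation rule of a semidirect product: conjugating a translation by a
  permutation of the coordinates permutes its sign vector.\<close>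

lemma klein_permute:
  assumes "even_signs e" "q permutes {..<3}"
  shows "klein e \<circ> q = q \<circ> klein (\<lambda>i. e (q i))"
proof
  fix j :: nat
  have out: "q i = i" if "\<not> i < 3" for i
    using permutes_not_in[OF assms(2), of i] that by simp
  consider "j = 0" | "j = 1" | "j = 2" | "j = 3" | "3 < j" by linarith
  then show "(klein e \<circ> q) j = (q \<circ> klein (\<lambda>i. e (q i))) j"
    using assms(1) permutes_3_cases[OF assms(2)] out[of 3] out[of j]
    unfolding even_signs_def insert_iff empty_iff prod.inject
    by cases (elim disjE conjE; simp add: klein_def transpose_def)+
qed

lemma klein_permutes: "klein e permutes {..<4}"
proof -
  have "transpose i j permutes {..<4}" if "i < 4" "j < 4" for i j :: nat
    using that by (intro permutes_swap_id) auto
  then show ?thesis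
    unfolding klein_def by (auto intro!: permutes_compose simp: permutes_id)
qed

lemma sign_klein: "sign (klein e) = 1"
  by (simp add: klein_def sign_compose permutation_swap_id sign_swap_id)

text \<open>For \<open>m\<close> nonzero the defining relation of
  \<open>signed_group (Suc m)\<close> equates the product of the section signs with the sign at the
  root, which is 1 here.\<close>

lemma even_signs_section_sign:
  assumes "m \<noteq> 0" "g \<in> even_group (Suc m)"
  shows "even_signs (section_sign g)"
proof -
  have gs: "g \<in> signed_group (Suc m)"
    using assms(2) by (simp add: even_group_def)
  obtain s p where sp: "g = node m s p" "p permutes {..<3}"
    "m \<noteq> 0 \<Longrightarrow> sign p = (\<Prod>i<3. root_sign (s i))"
    using signed_group_SucE[OF gs] by metis
  have "(\<Prod>i<3. section_sign g i) = 1"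
  proof -
    have "(\<Prod>i<3. section_sign g i) = (\<Prod>i<3. root_sign (s i))"
      unfolding sp(1) using section_sign_node[OF assms(1)] by (intro prod.cong) auto
    also have "\<dots> = sign p" using sp(3)[OF assms(1)] by simp
    also have "\<dots> = 1"
      using assms(2) root_sign_node[OF sp(2), of m s] unfolding sp(1) by (simp add: even_group_def)
    finally show ?thesis .
  qed
  then show ?thesis
    using root_sign_cases[of "subtree g 0"] root_sign_cases[of "subtree g 1"]
      root_sign_cases[of "subtree g 2"]
    by (auto simp: even_signs_def section_sign_def lessThan_3)
qed

section \<open>The action on four points\<close>

text \<open>The translation is on the right because sections act before the root permutation. The
  factor \<open>root_perm g\<close> fixes the point 3.\<close>

definition A4_map :: "(nat list \<Rightarrow> nat list) \<Rightarrow> nat \<Rightarrow> nat" where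
  "A4_map g = root_perm g \<circ> klein (section_sign g)"

lemma klein_cong: "(\<And>i. i < 3 \<Longrightarrow> e i = f i) \<Longrightarrow> klein e = klein f"
  by (simp add: klein_def)

text \<open>Moving \<open>q\<close> to the left past the translation of \<open>g\<close> replaces
  its vector by \<open>section_sign g (q i)\<close>, which is the same twist that occurs in the
  sections of a product.\<close>

lemma A4_map_comp:
  assumes m: "m \<noteq> 0" and g: "g \<in> even_group (Suc m)" and h: "h \<in> even_group (Suc m)"
  shows "A4_map (g \<circ> h) = A4_map g \<circ> A4_map h"
proof -
  have gs: "g \<in> signed_group (Suc m)" and hs: "h \<in> signed_group (Suc m)"
    using g h by (auto simp: even_group_def)
  obtain s p where sp: "g = node m s p" "\<And>i. i < 3 \<Longrightarrow> s i \<in> signed_group m" "p permutes {..<3}"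
    using signed_group_SucE[OF gs] by metis
  obtain t q where tq: "h = node m t q" "\<And>i. i < 3 \<Longrightarrow> t i \<in> signed_group m" "q permutes {..<3}"
    using signed_group_SucE[OF hs] by metis
  have q: "q i < 3" if "i < 3" for i
    using permutes_in_image[OF tq(3), of i] that by simp
  have e: "even_signs (section_sign g)" "even_signs (section_sign h)"
    using even_signs_section_sign[OF m] g h by auto
  have sec: "section_sign (g \<circ> h) i = section_sign g (q i) * section_sign h i" if "i < 3" for i
    using that m sp tq q root_sign_comp[of "s (q i)" m "t i"]
    by (simp add: node_comp_signed_group section_sign_node)
  have eq: "even_signs (\<lambda>i. section_sign g (q i))"
    using e(1) permutes_3_cases[OF tq(3)]
    unfolding even_signs_def insert_iff empty_iff prod.inject by (elim disjE conjE; simp)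
  have "A4_map g \<circ> A4_map h = p \<circ> (klein (section_sign g) \<circ> q) \<circ> klein (section_sign h)"
    using sp tq by (simp add: A4_map_def root_perm_node comp_assoc)
  also have "\<dots> = p \<circ> q \<circ> (klein (\<lambda>i. section_sign g (q i)) \<circ> klein (section_sign h))"
    by (simp add: klein_permute[OF e(1) tq(3)] comp_assoc)
  also have "\<dots> = p \<circ> q \<circ> klein (section_sign (g \<circ> h))"
    using sec by (simp add: klein_comp[OF eq e(2)] cong: klein_cong)
  also have "\<dots> = A4_map (g \<circ> h)"
    using sp tq root_perm_comp[OF gs hs] by (simp add: A4_map_def root_perm_node)
  finally show ?thesis by (rule sym)
qed

lemma A4_map_permutes:
  assumes "g \<in> even_group m"
  shows "A4_map g permutes {..<4}" "sign (A4_map g) = 1"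
proof -
  have p: "root_perm g permutes {..<3}" "sign (root_perm g) = 1"
    using assms root_perm_permutes by (auto simp: even_group_def root_sign_def)
  have "root_perm g permutes {..<4}"
    by (rule permutes_subset[OF p(1)]) auto
  then show "A4_map g permutes {..<4}"
    unfolding A4_map_def by (intro permutes_compose klein_permutes)
  have "permutation (klein (section_sign g))"
    by (rule permutes_imp_permutation[OF finite_lessThan klein_permutes])
  then show "sign (A4_map g) = 1"
    using p by (simp add: A4_map_def sign_compose permutation_permutes_3 sign_klein)
qed

text \<open>The root permutation fixes 3, so the translation has to fix 3 as well. A nontrivial
  translation has no fixed point, so all sections are even, and then the root permutation is trivial
  too.\<close>

lemma A4_map_eq_id:
  assumes m: "m \<noteq> 0" and g: "g \<in> even_group (Suc m)" and id: "A4_map g = id"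
  obtains a b c where "a \<in> even_group m" "b \<in> even_group m" "c \<in> even_group m"
    "g = wreath (Suc m) a b c id"
proof -
  have gs: "g \<in> signed_group (Suc m)"
    using g by (auto simp: even_group_def)
  obtain s p where sp: "g = node m s p" "\<And>i. i < 3 \<Longrightarrow> s i \<in> signed_group m" "p permutes {..<3}"
    using signed_group_SucE[OF gs] by metis
  have e: "even_signs (section_sign g)"
    using even_signs_section_sign[OF m g] .
  have pk: "p (klein (section_sign g) j) = j" for j
    using fun_cong[OF id, of j] sp(3) by (simp add: A4_map_def sp(1) root_perm_node)
  have "p 3 = 3" using permutes_not_in[OF sp(3), of 3] by simp
  then have "klein (section_sign g) 3 = 3"
    using pk[of 3] permutes_inj[OF sp(3)] by (metis injD)
  then have triv: "section_sign g 0 = 1" "section_sign g 1 = 1" "section_sign g 2 = 1"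
    using e by (auto simp: klein_def even_signs_def transpose_def split: if_splits)
  then have "p = id" using pk by (simp add: klein_def fun_eq_iff)
  moreover have "s 0 \<in> even_group m" "s 1 \<in> even_group m" "s 2 \<in> even_group m"
    using triv sp(2) section_sign_node[OF m] unfolding sp(1) by (simp_all add: even_group_def)
  ultimately show thesis using that sp(1) by (simp add: node_def)
qed

text \<open>A translation taking 3 to the preimage \<open>k\<close> of 3 under \<open>q\<close> is
  composed with \<open>q\<close>. The result \<open>r\<close> fixes 3 and serves as root
  permutation.\<close>

lemma A4_map_surj:
  assumes m: "m \<noteq> 0" and q: "q permutes {..<4}" "sign q = 1"
  shows "\<exists>g \<in> even_group (Suc m). A4_map g = q"
proof -
  obtain k where k: "q k = 3" using permutes_surj[OF q(1)] by (metis surjD)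
  have "k < 4" using permutes_in_image[OF q(1), of k] k by simp
  then have "k = 0 \<or> k = 1 \<or> k = 2 \<or> k = 3" by arith
  \<comment> \<open>For \<open>k < 3\<close> the vector with a single -1 at \<open>k\<close> has
    product -1; its negative lies in the same class and has product 1.\<close>
  then obtain e where e: "even_signs e" "klein e 3 = k"
  proof (elim disjE)
    assume "k = 0"
    then show thesis
      by (intro that[of "\<lambda>i. if i = 0 then 1 else - 1"]) (auto simp: even_signs_def klein_def)
  next
    assume "k = 1"
    then show thesis
      by (intro that[of "\<lambda>i. if i = 1 then 1 else - 1"]) (auto simp: even_signs_def klein_def)
  next
    assume "k = 2"
    then show thesis
      by (intro that[of "\<lambda>i. if i = 2 then 1 else - 1"]) (auto simp: even_signs_def klein_def)
  next
    assume "k = 3"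
    then show thesis
      by (intro that[of "\<lambda>i. 1"]) (auto simp: even_signs_def klein_def)
  qed
  define r where "r = q \<circ> klein e"
  have r4: "r permutes {..<4}"
    unfolding r_def by (intro permutes_compose klein_permutes q)
  have r: "r permutes {..<3}"
  proof (rule permutes_superset[OF r4])
    fix x :: nat assume "x \<in> {..<4} - {..<3}"
    then have "x = 3" by auto
    then show "r x = x" using e k by (simp add: r_def)
  qed
  have perm: "permutation q" "permutation (klein e)"
    by (rule permutes_imp_permutation[OF finite_lessThan q(1)]
        permutes_imp_permutation[OF finite_lessThan klein_permutes])+
  have sr: "sign r = 1"
    unfolding r_def using q perm by (simp add: sign_compose sign_klein)
  have "klein e \<circ> klein e = id"
    using klein_comp[OF e(1) e(1)] e(1)
    unfolding even_signs_def insert_iff empty_iff prod.inject by (elim disjE conjE; simp add: klein_def)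
  then have rq: "r \<circ> klein e = q"
    by (simp add: r_def comp_assoc)
  \<comment> \<open>The element \<open>tree_y m\<close> is odd since \<open>m\<close> is nonzero, so
    these sections have the prescribed signs.\<close>
  let ?s = "\<lambda>i. if e i = 1 then id else tree_y m"
  let ?g = "node m ?s r"
  have s: "root_sign (?s i) = e i" if "i < 3" for i
  proof -
    have "e i = 1 \<or> e i = - 1"
      using that e(1) all_less_3[of "\<lambda>i. e i = 1 \<or> e i = - 1"] by (auto simp: even_signs_def)
    then show ?thesis using tree_y_signed[of m] m by (auto simp: root_sign_id)
  qed
  have "?g \<in> signed_group (Suc m)"
  proof (rule node_in_signed_group[OF _ r])
    show "?s i \<in> signed_group m" for i
      using id_in_signed_group tree_y_signed by simp
    have "(\<Prod>i<3. root_sign (?s i)) = (\<Prod>i<3. e i)"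
      using s by (intro prod.cong) auto
    then show "sign r = (\<Prod>i<3. root_sign (?s i))"
      using sr e(1) by (auto simp: lessThan_3 even_signs_def)
  qed
  then have "?g \<in> even_group (Suc m)"
    using sr r by (simp add: even_group_def root_sign_node)
  moreover have "klein (section_sign ?g) = klein e"
    using s section_sign_node[OF m] by (intro klein_cong) simp
  then have "A4_map ?g = q"
    using rq r by (simp add: A4_map_def root_perm_node)
  ultimately show ?thesis by blast
qed

section \<open>Transfer to \<open>alt_group 4\<close>, and the kernel as normal closure\<close>

text \<open>Carries the points \<open>{0, 1, 2, 3}\<close> of the action to the points \<open>{1, 2, 3, 4}\<close> of \<open>alt_group 4\<close>.\<close>

abbreviation (input) shift :: "nat \<Rightarrow> nat" where
  "shift \<equiv> transpose 0 4"

lemma permutes_conj_transpose: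
  assumes "q permutes S"
  shows "transpose a b \<circ> q \<circ> transpose a b permutes transpose a b ` S"
proof -
  have "bij (transpose a b \<circ> q \<circ> transpose a b)"
    using permutes_bij[OF assms] by (intro bij_comp) auto
  moreover have "(transpose a b \<circ> q \<circ> transpose a b) x = x" if "x \<notin> transpose a b ` S" for x
  proof -
    have "transpose a b x \<notin> S" using that by (metis imageI transpose_involutory)
    then show ?thesis using permutes_not_in[OF assms] by simp
  qed
  ultimately show ?thesis by (auto simp: permutes_def bij_iff)
qed

lemma shift_image: "shift ` {..<4} = {1..4}" "shift ` {1..4} = {..<4}"
proof -
  have *: "{..<4} = {0, 1, 2, 3 :: nat}" "{1..4} = {1, 2, 3, 4 :: nat}" by auto
  show "shift ` {..<4} = {1..4}" "shift ` {1..4} = {..<4}"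
    unfolding * by (auto simp: transpose_def)
qed

lemma sign_conj_transpose:
  "permutation q \<Longrightarrow> sign (transpose a b \<circ> q \<circ> transpose a b) = sign q"
  by (simp add: sign_compose permutation_swap_id permutation_compose sign_swap_id)

lemma evenperm_iff_sign: "evenperm p \<longleftrightarrow> sign p = 1"
  by (simp add: sign_def)

definition A4_hom :: "(nat list \<Rightarrow> nat list) \<Rightarrow> nat \<Rightarrow> nat" where
  "A4_hom g = shift \<circ> A4_map g \<circ> shift"

lemma A4_hom_group_hom:
  assumes "m \<noteq> 0"
  shows "group_hom (L_group (Suc m)) (alt_group 4) A4_hom"
proof (intro group_hom.intro group_hom_axioms.intro L_group_group alt_group_is_group homI)
  show "A4_hom g \<in> carrier (alt_group 4)" if "g \<in> carrier (L_group (Suc m))" for g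
  proof -
    have g: "g \<in> even_group (Suc m)"
      using that by (simp add: L_group_def L_set_eq_even_group del: L_set.simps)
    have "permutation (A4_map g)"
      by (rule permutes_imp_permutation[OF finite_lessThan A4_map_permutes(1)[OF g]])
    then show ?thesis
      using A4_map_permutes[OF g] permutes_conj_transpose[of "A4_map g" "{..<4}" 0 4]
      unfolding alt_group_carrier A4_hom_def evenperm_iff_sign shift_image
      by (simp add: sign_conj_transpose)
  qed
  fix g h assume "g \<in> carrier (L_group (Suc m))" "h \<in> carrier (L_group (Suc m))"
  then have gh: "g \<in> even_group (Suc m)" "h \<in> even_group (Suc m)"
    by (simp_all add: L_group_def L_set_eq_even_group del: L_set.simps)
  have "A4_hom (g \<circ> h) = A4_hom g \<circ> A4_hom h"
    unfolding A4_hom_def A4_map_comp[OF assms gh] by (simp add: fun_eq_iff)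
  then show "A4_hom (g \<otimes>\<^bsub>L_group (Suc m)\<^esub> h) = A4_hom g \<otimes>\<^bsub>alt_group 4\<^esub> A4_hom h"
    by (simp add: L_group_def alt_group_mult)
qed

lemma A4_hom_surj:
  assumes "m \<noteq> 0"
  shows "A4_hom ` carrier (L_group (Suc m)) = carrier (alt_group 4)"
proof
  show "A4_hom ` carrier (L_group (Suc m)) \<subseteq> carrier (alt_group 4)"
    using group_hom.hom_closed[OF A4_hom_group_hom[OF assms]] by blast
  show "carrier (alt_group 4) \<subseteq> A4_hom ` carrier (L_group (Suc m))"
  proof
    fix q assume "q \<in> carrier (alt_group 4)"
    then have q: "q permutes {1..4}" "sign q = 1"
      by (simp_all add: alt_group_carrier evenperm_iff_sign)
    have "permutation q" by (rule permutes_imp_permutation[OF _ q(1)]) simp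
    then have "\<exists>g \<in> even_group (Suc m). A4_map g = shift \<circ> q \<circ> shift"
      using permutes_conj_transpose[OF q(1), of 0 4] q(2)
      unfolding shift_image by (intro A4_map_surj[OF assms]) (simp_all add: sign_conj_transpose)
    then obtain g where g: "g \<in> even_group (Suc m)" "A4_map g = shift \<circ> q \<circ> shift" by blast
    have "A4_hom g = q"
      by (simp add: A4_hom_def g(2) fun_eq_iff)
    then show "q \<in> A4_hom ` carrier (L_group (Suc m))"
      using g(1) by (auto simp: L_group_def L_set_eq_even_group simp del: L_set.simps)
  qed
qed

text \<open>The kernel is normal and contains the embedded copy of \<open>L_set m\<close>, so it
  contains the closure. Conversely, a normal subgroup containing the first factor contains its
  conjugates by \<open>tree_x (Suc m)\<close>, which are the other two factors, and the kernel is
  the product of the three.\<close>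

lemma H_set_eq_kernel:
  assumes m: "m \<noteq> 0"
  shows "H_set (Suc m) = kernel (L_group (Suc m)) (alt_group 4) A4_hom"
proof
  let ?L = "L_group (Suc m)" and ?w = "wreath (Suc m)"
  interpret group_hom ?L "alt_group 4" A4_hom by (rule A4_hom_group_hom[OF m])
  have id_even: "id \<in> even_group m" by (rule id_in_even_group)
  have carrier: "carrier ?L = even_group (Suc m)"
    by (simp add: L_group_def L_set_eq_even_group del: L_set.simps)
  have mult: "g \<otimes>\<^bsub>?L\<^esub> h = g \<circ> h" for g h
    by (simp add: L_group_def)
  have w_even: "?w a b c id \<in> even_group (Suc m)"
    if "a \<in> even_group m" "b \<in> even_group m" "c \<in> even_group m" for a b c
    using that by (simp add: even_group_def wreath_in_signed_group root_sign_wreath permutes_id)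
  have even: "\<And>g. g \<in> even_group m \<Longrightarrow> g \<in> carrier (Aut_tree m)"
    using subgroup.subset[OF even_group_subgroup] by blast
  have "tree_embed (Suc m) l \<in> kernel ?L (alt_group 4) A4_hom" if "l \<in> even_group m" for l
  proof -
    have "section_sign (tree_embed (Suc m) l) i = 1" if "i < 3" for i
      using that \<open>l \<in> even_group m\<close> all_less_3[of "\<lambda>i. root_sign ([l, id, id] ! i) = 1"]
      unfolding tree_embed_def wreath_eq_node section_sign_node[OF m that]
      by (simp add: even_group_def root_sign_id)
    then have "A4_map (tree_embed (Suc m) l) = id"
      by (simp add: A4_map_def klein_def tree_embed_def wreath_eq_node root_perm_node permutes_id)
    then show ?thesis
      using w_even[OF that id_even id_even]
      by (simp add: kernel_def carrier A4_hom_def alt_group_one tree_embed_def)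
  qed
  then show "H_set (Suc m) \<subseteq> kernel ?L (alt_group 4) A4_hom"
    unfolding H_set_def normal_closure_def diff_Suc_1 L_set_eq_even_group
    using normal_kernel by blast
  show "kernel ?L (alt_group 4) A4_hom \<subseteq> H_set (Suc m)"
    unfolding H_set_def normal_closure_def
  proof (intro subsetI InterI)
    fix g N assume g: "g \<in> kernel ?L (alt_group 4) A4_hom"
      and "N \<in> {N. N \<lhd> ?L \<and> tree_embed (Suc m) ` L_set (Suc m - 1) \<subseteq> N}"
    then have N: "N \<lhd> ?L" and l0: "\<And>l. l \<in> even_group m \<Longrightarrow> ?w l id id id \<in> N"
      by (auto simp: L_set_eq_even_group tree_embed_def)
    have x: "tree_x (Suc m) \<in> even_group (Suc m)" by (rule tree_x_even)
    \<comment> \<open>The conjugation is expressed as a commutation equation, which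
      \<open>wreath_comp\<close> can verify without an inverse.\<close>
    have conj: "h \<in> N"
      if "h \<circ> tree_x (Suc m) = tree_x (Suc m) \<circ> k" "k \<in> N" "h \<in> even_group (Suc m)" for h k
    proof -
      have k: "k \<in> carrier ?L"
        using subgroup.mem_carrier[OF normal_imp_subgroup[OF N] that(2)] .
      have xh: "tree_x (Suc m) \<in> carrier ?L" "h \<in> carrier ?L"
        unfolding carrier by (rule x that(3))+
      have "h = tree_x (Suc m) \<otimes>\<^bsub>?L\<^esub> k \<otimes>\<^bsub>?L\<^esub> inv\<^bsub>?L\<^esub> tree_x (Suc m)"
        by (rule G.inv_solve_right[THEN iffD2, OF xh(2) G.m_closed[OF xh(1) k] xh(1)])
          (simp only: mult that(1))
      then show ?thesis
        using normal.inv_op_closed2[OF N _ that(2), of "tree_x (Suc m)"] x carrier by simp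
    qed
    note comp_simps = wreath_comp id_in_Aut_tree cycle_permutes_sign cycle_012 even permutes_id
      tree_gens_in_Aut_tree
    have l1: "?w id l id id \<in> N" if "l \<in> even_group m" for l
      by (rule conj[OF _ l0[OF that] w_even])
        (use that id_even in \<open>simp_all add: comp_simps\<close>)
    have l2: "?w id id l id \<in> N" if "l \<in> even_group m" for l
      by (rule conj[OF _ l1[OF that] w_even])
        (use that id_even in \<open>simp_all add: comp_simps\<close>)
    have "A4_hom g = id" and gL: "g \<in> even_group (Suc m)"
      using g by (auto simp: kernel_def alt_group_one carrier)
    \<comment> \<open>The transposition is its own inverse, so conjugating twice gives back
      \<open>A4_map g\<close>.\<close>
    have "A4_map g = shift \<circ> A4_hom g \<circ> shift"
      by (simp add: A4_hom_def fun_eq_iff)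
    then have "A4_map g = id" using \<open>A4_hom g = id\<close> by simp
    then obtain a b c where abc: "a \<in> even_group m" "b \<in> even_group m" "c \<in> even_group m"
      "g = ?w a b c id"
      using A4_map_eq_id[OF m gL] by metis
    have "g = ?w a id id id \<circ> (?w id b id id \<circ> ?w id id c id)"
      using abc by (simp add: comp_simps)
    then show "g \<in> N"
      using l0 l1 l2 abc subgroup.m_closed[OF normal_imp_subgroup[OF N]] mult by metis
  qed
qed

theorem theorem3p10:
  fixes n :: nat
  assumes "n \<ge> 2"
  shows "card (rcosets\<^bsub>L_group n\<^esub> (H_set n)) = 12 \<and> L_group n Mod H_set n \<cong> alt_group 4"
proof -
  obtain m where n: "n = Suc m" and m: "m \<noteq> 0"
    using assms by (cases n) auto
  have iso: "L_group n Mod H_set n \<cong> alt_group 4"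
    unfolding n H_set_eq_kernel[OF m]
    by (rule group_hom.FactGroup_iso[OF A4_hom_group_hom[OF m] A4_hom_surj[OF m]])
  have "card (carrier (alt_group 4)) = 12"
    using alt_group_card_carrier[of 4] by (simp add: fact_numeral)
  \<comment> \<open>The cosets are the carrier of the quotient group, so the isomorphism also yields
    the index.\<close>
  then have "card (rcosets\<^bsub>L_group n\<^esub> (H_set n)) = 12"
    using iso_same_card[OF iso] by (simp add: FactGroup_def)
  with iso show ?thesis by blast
qed

end
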